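(* Let $\alpha\in[0,1]$. Let $G$ be a graph of order $n\ge 3$ with vertex set $\{v_1,\dots,v_n\}$ and $m$ edges. For $i=1,\dots,n$, let $G_i$ be an $r_i$-regular graph of order $n_i$ with adjacency eigenvalues $\lambda_{i1}=r_i\ge \lambda_{i2}\ge\dots\ge\lambda_{in_i}$. For $i=1,\dots,n$ put $\alpha_i=\sum_{v_j\in N_G(v_i)} n_j$. Then the $A_\alpha$-spectrum of the joined union $H=G[G_1,\dots,G_n]$ (of order $N=\sum_{i=1}^n n_i$) consists of the eigenvalues $\alpha(r_i+\alpha_i)+(1-\alpha)\lambda_{ik}$ for $i=1,\dots,n$ and $k=2,\dots,n_i$, together with the $n$ eigenvalues of the $n\times n$ matrix $M=(M_{ij})$ given by $M_{ii}=\alpha\alpha_i+r_i$, and for $i\ne j$, $M_{ij}=(1-\alpha)n_j$ if $v_i\sim v_j$ in $G$ and $M_{ij}=0$ if $v_i\nsim v_j$.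
   Context: For a simple graph $G$ with adjacency matrix $A(G)$ and diagonal degree matrix $D(G)$, and $\alpha\in[0,1]$, $A_\alpha(G)=\alpha D(G)+(1-\alpha)A(G)$; its $A_\alpha$-spectrum is the multiset of eigenvalues of $A_\alpha(G)$. $N_G(v)$ denotes the set of neighbours of $v$ in $G$. Given a graph $G$ with vertices $v_1,\dots,v_n$ and graphs $G_i=(V_i,E_i)$, the joined union $G[G_1,\dots,G_n]$ is the graph with vertex set $\bigcup_i V_i$ (disjoint) and edge set $\bigcup_i E_i\cup\bigcup_{v_iv_j\in E(G)}\{xy: x\in V_i,y\in V_j\}$, i.e. the disjoint union of the $G_i$ with every vertex of $G_i$ joined to every vertex of $G_j$ whenever $v_iv_j$ is an edge of $G$. *)

theory Defs
  imports "Graph_Theory.Pair_Digraph" "Jordan_Normal_Form.Char_Poly"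
    "HOL-Library.Multiset"
begin

text \<open>
  A finite simple graph is a \<^locale>\<open>pair_graph\<close>: a finite, loop-free digraph whose arc relation is
  symmetric, an edge \<open>xy\<close> being represented by the two arcs \<open>(x, y)\<close> and \<open>(y, x)\<close>.
\<close>

definition edges :: "'a pair_pre_digraph \<Rightarrow> 'a set set" where
  "edges G = {{x, y} | x y. (x, y) \<in> parcs G}"

definition neighbours :: "'a pair_pre_digraph \<Rightarrow> 'a \<Rightarrow> 'a set" where
  "neighbours G x = {y \<in> pverts G. (x, y) \<in> parcs G}"

definition regular_graph :: "nat \<Rightarrow> 'a pair_pre_digraph \<Rightarrow> bool" where
  "regular_graph r G \<longleftrightarrow> pair_graph G \<and> (\<forall>x \<in> pverts G. card (neighbours G x) = r)"

text \<open>
  Matrices of a graph are taken with respect to a list enumerating its vertices; rows and columns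
  are indexed from \<open>0\<close>.
\<close>

definition vertex_enum :: "'a pair_pre_digraph \<Rightarrow> 'a list \<Rightarrow> bool" where
  "vertex_enum G vs \<longleftrightarrow> distinct vs \<and> set vs = pverts G"

definition adjacency_mat :: "'a pair_pre_digraph \<Rightarrow> 'a list \<Rightarrow> real mat" where
  "adjacency_mat G vs =
     mat (length vs) (length vs) (\<lambda>(i, j). if (vs ! i, vs ! j) \<in> parcs G then 1 else 0)"

definition degree_mat :: "'a pair_pre_digraph \<Rightarrow> 'a list \<Rightarrow> real mat" where
  "degree_mat G vs =
     mat (length vs) (length vs) (\<lambda>(i, j). if i = j then real (card (neighbours G (vs ! i))) else 0)"

definition A_alpha_mat :: "real \<Rightarrow> 'a pair_pre_digraph \<Rightarrow> 'a list \<Rightarrow> real mat" where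
  "A_alpha_mat \<alpha> G vs = \<alpha> \<cdot>\<^sub>m degree_mat G vs + (1 - \<alpha>) \<cdot>\<^sub>m adjacency_mat G vs"

text \<open>
  The eigenvalues, with algebraic multiplicity, are taken over the complex numbers, so that an
  \<open>n\<close>-by-\<open>n\<close> matrix always has exactly \<open>n\<close> of them.
\<close>

definition eigvals_mset :: "real mat \<Rightarrow> complex multiset" where
  "eigvals_mset A = proots (char_poly (map_mat complex_of_real A))"

text \<open>
  The list \<open>vs\<close> enumerates the vertices of \<open>G\<close>, and the graph \<open>Gs i\<close> is substituted for \<open>vs ! i\<close>.
  Tagging the vertices of \<open>Gs i\<close> with \<open>i\<close> makes the union of the vertex sets disjoint.
\<close>

definition joined_union ::
  "'a pair_pre_digraph \<Rightarrow> 'a list \<Rightarrow> (nat \<Rightarrow> 'b pair_pre_digraph) \<Rightarrow> (nat \<times> 'b) pair_pre_digraph"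
where
  "joined_union G vs Gs =
     \<lparr> pverts = (SIGMA i:{..<length vs}. pverts (Gs i)),
       parcs = {((i, x), (i, y)) | i x y. i < length vs \<and> (x, y) \<in> parcs (Gs i)} \<union>
               {((i, x), (j, y)) | i j x y. i < length vs \<and> j < length vs \<and>
                  (vs ! i, vs ! j) \<in> parcs G \<and> x \<in> pverts (Gs i) \<and> y \<in> pverts (Gs j)} \<rparr>"

lemma pair_graph_arc_sym:
  assumes "pair_graph G" and "(u, v) \<in> parcs G"
  shows "(v, u) \<in> parcs G"
proof -
  interpret pair_graph G by (rule assms)
  show ?thesis using pair_sym_arcs assms(2) by (auto simp: symmetric_def dest: symD)
qed

lemma pair_graph_joined_union:
  assumes G: "pair_graph G" and Gs: "\<And>i. i < length vs \<Longrightarrow> pair_graph (Gs i)"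
  shows "pair_graph (joined_union G vs Gs)"
proof -
  interpret G: pair_graph G by (rule G)
  let ?H = "joined_union G vs Gs"
  have wf: "fst e \<in> pverts ?H \<and> snd e \<in> pverts ?H \<and> fst e \<noteq> snd e" if "e \<in> parcs ?H" for e
  proof -
    from that consider
      (inner) i x y where "e = ((i, x), (i, y))" "i < length vs" "(x, y) \<in> parcs (Gs i)"
    | (outer) i j x y where "e = ((i, x), (j, y))" "i < length vs" "j < length vs"
        "(vs ! i, vs ! j) \<in> parcs G" "x \<in> pverts (Gs i)" "y \<in> pverts (Gs j)"
      by (auto simp: joined_union_def)
    then show ?thesis
    proof cases
      case inner
      interpret Gi: pair_graph "Gs i" by (rule Gs) (rule inner)
      show ?thesis using inner Gi.in_arcsD1 Gi.in_arcsD2 Gi.pair_no_loops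
        by (force simp: joined_union_def)
    next
      case outer
      then show ?thesis using G.pair_no_loops by (force simp: joined_union_def)
    qed
  qed
  have fin: "finite (pverts ?H)"
    using Gs by (auto simp: joined_union_def pair_graph_def pair_digraph_def
        pair_fin_digraph_def pair_fin_digraph_axioms_def)
  have "parcs ?H \<subseteq> pverts ?H \<times> pverts ?H" using wf by force
  then have fin': "finite (parcs ?H)" using fin by (meson finite_SigmaI finite_subset)
  have "sym (parcs ?H)"
  proof (rule symI)
    fix p q assume "(p, q) \<in> parcs ?H"
    then show "(q, p) \<in> parcs ?H"
      using pair_graph_arc_sym[OF G] pair_graph_arc_sym[OF Gs]
      by (auto simp: joined_union_def)
  qed
  then have "symmetric (with_proj ?H)" by (simp add: symmetric_def)
  then show ?thesis using wf fin fin' by unfold_locales auto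
qed

end

theory Submission
  imports Defs "Jordan_Normal_Form.Schur_Decomposition"
begin

text \<open>
  Write the matrix of the joined union as \<open>B + U W\<close>, where \<open>B\<close> is block diagonal with blocks
  \<open>\<alpha>(r\<^sub>i + \<alpha>\<^sub>i) I + (1 - \<alpha>) A(G\<^sub>i)\<close>, \<open>U\<close> is the \<open>N\<close>-by-\<open>n\<close> indicator matrix of the vertex sets and
  \<open>W = (1 - \<alpha>) A(G) U\<^sup>T\<close>. Regularity of the \<open>G\<^sub>i\<close> gives \<open>B U = U L\<close> with the diagonal matrix
  \<open>L = diag(\<alpha>\<alpha>\<^sub>i + r\<^sub>i)\<close>, and \<open>M = L + W U\<close>. Conjugating a block triangular matrix with diagonal blocks
  \<open>B\<close> and \<open>M\<close> by a unipotent matrix yields one with diagonal blocks \<open>B + U W\<close> and \<open>L\<close>, so that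
  spec(\<open>B + U W\<close>) + spec(\<open>L\<close>) = spec(\<open>B\<close>) + spec(\<open>M\<close>). The entries of \<open>L\<close> are exactly the
  eigenvalues of the blocks of \<open>B\<close> that belong to \<open>\<lambda>\<^sub>i\<^sub>1 = r\<^sub>i\<close>, and they cancel.
\<close>

section \<open>Eigenvalue multisets of complex matrices\<close>

abbreviation spectrum_mset :: "complex mat \<Rightarrow> complex multiset" where
  "spectrum_mset A \<equiv> proots (char_poly A)"

lemma char_poly_nonzero:
  fixes A :: "complex mat"
  assumes "A \<in> carrier_mat n n"
  shows "char_poly A \<noteq> 0"
  using degree_monic_char_poly[OF assms] by auto

lemma spectrum_mset_upper_triangular:
  assumes "A \<in> carrier_mat n n" and "upper_triangular A"
  shows "spectrum_mset A = mset (diag_mat A)"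
proof -
  have "spectrum_mset A = proots (\<Prod>p\<leftarrow>map (\<lambda>a. [:- a, 1:]) (diag_mat A). p)"
    using char_poly_upper_triangular[OF assms] by simp
  also have "\<dots> = (\<Sum>p\<leftarrow>map (\<lambda>a. [:- a, 1:]) (diag_mat A). proots p)"
    by (rule proots_prod_list) auto
  also have "\<dots> = (\<Sum>a\<leftarrow>diag_mat A. {#a#})" by (simp add: o_def)
  also have "\<dots> = mset (diag_mat A)" by (induction "diag_mat A" rule: list.induct) simp_all
  finally show ?thesis .
qed

text \<open>The characteristic polynomial of a block triangular matrix is a product; over the
  complex numbers both factors split, as \<open>char_poly_0_block'\<close> demands, and both are
  nonzero, so \<open>proots\<close> turns the product into a sum.\<close>

lemma spectrum_mset_block_lower:
  fixes A :: "complex mat"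
  assumes A: "A \<in> carrier_mat n n" and C: "C \<in> carrier_mat m n" and D: "D \<in> carrier_mat m m"
  shows "spectrum_mset (four_block_mat A (0\<^sub>m n m) C D) = spectrum_mset A + spectrum_mset D"
proof -
  have "char_poly (four_block_mat A (0\<^sub>m n m) C D) = char_poly A * char_poly D"
    using char_poly_0_block'[OF refl _ _ A C D] char_poly_factorized[OF A] char_poly_factorized[OF D]
    by blast
  then show ?thesis
    using char_poly_nonzero[OF A] char_poly_nonzero[OF D] by (simp add: proots_mult)
qed

text \<open>By Schur triangularisation \<open>A = P * T * Q\<close> with \<open>Q\<close> inverse to
  \<open>P\<close>. The affine map commutes with this conjugation, keeps \<open>T\<close> triangular
  and acts on its diagonal entry by entry.\<close>

lemma spectrum_mset_affine:
  fixes A :: "complex mat"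
  assumes A: "A \<in> carrier_mat n n"
  shows "spectrum_mset (c \<cdot>\<^sub>m 1\<^sub>m n + d \<cdot>\<^sub>m A) = image_mset (\<lambda>a. c + d * a) (spectrum_mset A)"
proof -
  obtain as where "char_poly A = (\<Prod>a\<leftarrow>as. [:- a, 1:])"
    using char_poly_factorized[OF A] by blast
  from schur_decomposition_exists[OF A this] obtain T
    where T: "T \<in> carrier_mat n n" and ut: "upper_triangular T" and sim: "similar_mat A T"
    by blast
  from sim obtain P Q where "similar_mat_wit A T P Q"
    unfolding similar_mat_def by blast
  note wit = similar_mat_witD2[OF A this]
  have P: "P \<in> carrier_mat n n" and Q: "Q \<in> carrier_mat n n"
    and PQ: "P * Q = 1\<^sub>m n" "Q * P = 1\<^sub>m n" and AT: "A = P * T * Q"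
    using wit by blast+
  let ?f = "\<lambda>X. c \<cdot>\<^sub>m 1\<^sub>m n + d \<cdot>\<^sub>m X"
  have "P * ?f T * Q = P * (c \<cdot>\<^sub>m 1\<^sub>m n) * Q + P * (d \<cdot>\<^sub>m T) * Q"
    using P Q T by (simp add: mult_add_distrib_mat[of _ n n _ n] add_mult_distrib_mat[of _ n n _ _ n])
  also have "\<dots> = ?f A"
    using P Q T PQ AT by (simp add: mult_smult_distrib[of _ n n _ n] mult_smult_assoc_mat[of _ n n _ n])
  finally have "similar_mat (?f A) (?f T)"
    using A P Q T PQ by (intro similar_matI[of _ _ P Q n]) auto
  then have "spectrum_mset (?f A) = spectrum_mset (?f T)"
    by (simp add: char_poly_similar)
  also have "\<dots> = mset (diag_mat (?f T))"
    using T ut by (intro spectrum_mset_upper_triangular[of _ n]) (auto simp: upper_triangular_def)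
  also have "diag_mat (?f T) = map (\<lambda>a. c + d * a) (diag_mat T)"
    using T by (auto simp: diag_mat_def)
  also have "mset \<dots> = image_mset (\<lambda>a. c + d * a) (spectrum_mset A)"
    using spectrum_mset_upper_triangular[OF T ut] char_poly_similar[OF sim] by simp
  finally show ?thesis .
qed

text \<open>The relation \<open>B * U = U * L\<close> makes the column space of \<open>U\<close>
  invariant under \<open>B\<close>, with \<open>L\<close> describing the action, so the update
  \<open>U * W\<close> trades the spectrum of \<open>L\<close> for that of \<open>L + W * U\<close>.
  Keeping \<open>L\<close> on the left avoids multiset subtraction.\<close>

lemma spectrum_mset_equitable:
  fixes B :: "complex mat"
  assumes B: "B \<in> carrier_mat n n" and U: "U \<in> carrier_mat n k"
    and W: "W \<in> carrier_mat k n" and L: "L \<in> carrier_mat k k"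
    and BU: "B * U = U * L"
  shows "spectrum_mset (B + U * W) + spectrum_mset L = spectrum_mset B + spectrum_mset (L + W * U)"
proof -
  let ?X = "four_block_mat (B + U * W) (0\<^sub>m n k) W L"
  let ?Y = "four_block_mat B (0\<^sub>m n k) W (L + W * U)"
  let ?P = "four_block_mat (1\<^sub>m n) U (0\<^sub>m k n) (1\<^sub>m k)"
  let ?Q = "four_block_mat (1\<^sub>m n) (- U) (0\<^sub>m k n) (1\<^sub>m k)"
  \<comment> \<open>\<open>?X = ?P * ?Y * ?Q\<close>, as the upper right block of the product is
      \<open>- (B + U * W) * U + U * (L + W * U) = U * L - B * U = 0\<close>\<close>
  have UU: "U + - U = 0\<^sub>m n k" "- U + U = 0\<^sub>m n k"
    using U by (auto intro!: eq_matI)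
  have zero: "- 0\<^sub>m k k + 1\<^sub>m k = (1\<^sub>m k :: complex mat)"
    by (rule eq_matI) auto
  have PQ: "?P * ?Q = 1\<^sub>m (n + k)" "?Q * ?P = 1\<^sub>m (n + k)"
    using U UU zero
    by (subst mult_four_block_mat[of _ n n _ k _ k _ _ n _ k];
        auto simp: four_block_one_mat)+
  have PY: "?P * ?Y = four_block_mat (B + U * W) (U * (L + W * U)) W (L + W * U)"
    using U W L B by (subst mult_four_block_mat[of _ n n _ k _ k _ _ n _ k]) auto
  have 1: "(B + U * W) * - U + U * (L + W * U) = 0\<^sub>m n k"
  proof -
    have "(B + U * W) * - U = - (U * L + U * W * U)"
      using U W L B BU by (simp add: add_mult_distrib_mat[of _ n n _ _ k])
    moreover have "U * (L + W * U) = U * L + U * W * U"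
      using U W L by (simp add: mult_add_distrib_mat[of _ n k _ k])
    ultimately show ?thesis using U W L by (auto intro!: eq_matI)
  qed
  have 2: "W * - U + (L + W * U) = L"
    using U W L by (auto intro!: eq_matI)
  have "?P * ?Y * ?Q = ?X"
    unfolding PY using U W L B 1 2
    by (subst mult_four_block_mat[of _ n n _ k _ k _ _ n _ k]) auto
  then have "similar_mat ?X ?Y"
    using U W L B PQ by (intro similar_matI[of _ _ ?P ?Q "n + k"]) auto
  then have "spectrum_mset ?X = spectrum_mset ?Y" by (simp add: char_poly_similar)
  then show ?thesis
    using U W L B by (simp add: spectrum_mset_block_lower)
qed

section \<open>Matrices indexed by a list of vertices\<close>

text \<open>The kernel \<open>f\<close> lives on vertices rather than positions, so reordering the
  vertices or splitting them into blocks becomes an operation on the list alone.\<close>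

definition list_mat :: "('v \<Rightarrow> 'v \<Rightarrow> 'c) \<Rightarrow> 'v list \<Rightarrow> 'c mat" where
  "list_mat f xs = mat (length xs) (length xs) (\<lambda>(i, j). f (xs ! i) (xs ! j))"

lemma list_mat_carrier [simp]: "list_mat f xs \<in> carrier_mat (length xs) (length xs)"
  by (simp add: list_mat_def)

text \<open>Rows are permuted directly and columns through the transpose; each contributes the sign
  of \<open>p\<close>, and the two signs multiply to 1.\<close>

lemma det_permute_rows_cols:
  fixes A :: "'a :: idom mat"
  assumes A: "A \<in> carrier_mat n n" and p: "p permutes {0..<n}"
  shows "det (mat n n (\<lambda>(i, j). A $$ (p i, p j))) = det A"
proof -
  let ?R = "mat n n (\<lambda>(i, j). A $$ (p i, j))"
  have pn: "p i < n" if "i < n" for i using permutes_in_image[OF p, of i] that by simp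
  have "mat n n (\<lambda>(i, j). A $$ (p i, p j))
      = (mat n n (\<lambda>(i, j). ?R\<^sup>T $$ (p i, j)))\<^sup>T"
    by (rule eq_matI) (auto simp: pn)
  then have "det (mat n n (\<lambda>(i, j). A $$ (p i, p j)))
      = det (mat n n (\<lambda>(i, j). ?R\<^sup>T $$ (p i, j)))"
    by (simp only: det_transpose[OF mat_carrier])
  also have "\<dots> = signof p * det ?R\<^sup>T"
    by (rule det_permute_rows[OF _ p]) simp
  also have "det ?R\<^sup>T = signof p * det A"
    using det_permute_rows[OF A p] by (simp add: det_transpose[of _ n])
  also have "signof p * (signof p * det A) = det A"
    by (simp add: sign_def)
  finally show ?thesis .
qed

text \<open>Reordering the list permutes rows and columns simultaneously. Since \<open>p\<close> is
  injective it preserves the diagonal, so the characteristic matrix is permuted in the same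
  way.\<close>

lemma char_poly_list_mat_permute:
  fixes f :: "'v \<Rightarrow> 'v \<Rightarrow> 'a :: idom"
  assumes "mset xs = mset ys"
  shows "char_poly (list_mat f xs) = char_poly (list_mat f ys)"
proof -
  let ?n = "length ys"
  from mset_eq_permutation[OF assms] obtain p
    where p: "p permutes {..<?n}" and xs: "permute_list p ys = xs" by blast
  have len: "length xs = ?n" using assms mset_eq_length by blast
  have pn: "p i < ?n" if "i < ?n" for i using permutes_in_image[OF p, of i] that by simp
  have inj: "p i = p j \<longleftrightarrow> i = j" for i j using permutes_inj[OF p] by (auto dest: injD)
  have nth: "xs ! i = ys ! p i" if "i < ?n" for i
    using permute_list_nth[OF p that] xs by simp
  have "char_poly_matrix (list_mat f xs)
      = mat ?n ?n (\<lambda>(i, j). char_poly_matrix (list_mat f ys) $$ (p i, p j))"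
    by (rule eq_matI) (auto simp: char_poly_matrix_def list_mat_def len nth pn inj)
  then show ?thesis
    using det_permute_rows_cols[of "char_poly_matrix (list_mat f ys)" ?n p] p
    by (simp add: char_poly_def lessThan_atLeast0)
qed

lemma list_mat_append:
  assumes "\<And>x y. x \<in> set xs \<Longrightarrow> y \<in> set ys \<Longrightarrow> f x y = 0"
  shows "list_mat f (xs @ ys) = four_block_mat (list_mat f xs) (0\<^sub>m (length xs) (length ys))
    (mat (length ys) (length xs) (\<lambda>(i, j). f (ys ! i) (xs ! j))) (list_mat f ys)"
  using assms by (auto intro!: eq_matI simp: list_mat_def nth_append)

text \<open>Entries vanish from each list to all later ones, so splitting off the first list always
  leaves a block lower triangular matrix.\<close>

lemma spectrum_mset_list_mat_concat:
  fixes f :: "'v \<Rightarrow> 'v \<Rightarrow> complex"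
  assumes "sorted_wrt (\<lambda>xs ys. \<forall>x\<in>set xs. \<forall>y\<in>set ys. f x y = 0) xss"
  shows "spectrum_mset (list_mat f (concat xss)) = (\<Sum>xs\<leftarrow>xss. spectrum_mset (list_mat f xs))"
  using assms
proof (induction xss)
  case Nil
  have "spectrum_mset (list_mat f []) = {#}"
    by (subst spectrum_mset_upper_triangular[of _ 0]) (auto simp: list_mat_def diag_mat_def)
  then show ?case by simp
next
  case (Cons xs xss)
  then show ?case
    by (simp, subst list_mat_append) (auto simp: spectrum_mset_block_lower)
qed


section \<open>Tagged enumerations and degrees in a joined union\<close>

lemma sum_nth_conv_sum_set:
  assumes "distinct xs"
  shows "(\<Sum>i = 0..<length xs. f (xs ! i)) = sum f (set xs)"
proof -
  have "bij_betw ((!) xs) {0..<length xs} (set xs)"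
    using assms by (intro bij_betw_nth) (auto simp: lessThan_atLeast0)
  then show ?thesis by (rule sum.reindex_bij_betw)
qed

lemma distinct_concat_tagged:
  assumes "distinct is" and "\<And>i. i \<in> set is \<Longrightarrow> distinct (us i)"
  shows "distinct (concat (map (\<lambda>i. map (Pair i) (us i)) is))"
  using assms by (induction "is") (auto simp: distinct_map inj_on_def)

lemma parcs_joined_union:
  "((i, x), (j, y)) \<in> parcs (joined_union G vs Gs) \<longleftrightarrow>
    i < length vs \<and> j < length vs \<and>
    (i = j \<and> (x, y) \<in> parcs (Gs i) \<or>
     (vs ! i, vs ! j) \<in> parcs G \<and> x \<in> pverts (Gs i) \<and> y \<in> pverts (Gs j))"
  by (auto simp: joined_union_def)

text \<open>The neighbourhood of \<open>(i, x)\<close> consists of a tagged copy of that of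
  \<open>x\<close> in \<open>Gs i\<close> and of all of \<open>Gs j\<close> for each
  \<open>vs ! j\<close> adjacent to \<open>vs ! i\<close>. These are disjoint because
  \<open>G\<close> has no loops.\<close>

lemma card_neighbours_joined_union:
  assumes G: "pair_graph G" and Gs: "\<And>j. j < length vs \<Longrightarrow> finite (pverts (Gs j))"
    and vs: "set vs \<subseteq> pverts G" and i: "i < length vs" and x: "x \<in> pverts (Gs i)"
  shows "card (neighbours (joined_union G vs Gs) (i, x)) =
    card (neighbours (Gs i) x) +
    (\<Sum>j | j < length vs \<and> vs ! j \<in> neighbours G (vs ! i). card (pverts (Gs j)))"
proof -
  interpret G: pair_graph G by (rule G)
  let ?J = "{j. j < length vs \<and> vs ! j \<in> neighbours G (vs ! i)}"
  have no_loop: "(v, v) \<notin> parcs G" for v using G.pair_no_loops by fastforce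
  have "neighbours (joined_union G vs Gs) (i, x) =
      Pair i ` neighbours (Gs i) x \<union> (SIGMA j:?J. pverts (Gs j))"
    using i x vs by (auto simp: neighbours_def parcs_joined_union subset_iff)
      (auto simp: joined_union_def)
  moreover have "Pair i ` neighbours (Gs i) x \<inter> (SIGMA j:?J. pverts (Gs j)) = {}"
    using no_loop by (auto simp: neighbours_def)
  moreover have "finite (neighbours (Gs i) x)"
    using Gs[OF i] by (simp add: neighbours_def)
  moreover have "finite (SIGMA j:?J. pverts (Gs j))"
    using Gs by (intro finite_SigmaI) auto
  moreover have "card (SIGMA j:?J. pverts (Gs j)) = (\<Sum>j\<in>?J. card (pverts (Gs j)))"
    using Gs by (intro card_SigmaI) auto
  ultimately show ?thesis
    by (simp add: card_Un_disjoint card_image inj_on_def)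
qed

theorem theorem2p3:
  fixes \<alpha> :: real
    and G :: "'a pair_pre_digraph" and vs :: "'a list" and n m :: nat
    and Gs :: "nat \<Rightarrow> 'b pair_pre_digraph" and us :: "nat \<Rightarrow> 'b list"
    and ord r s :: "nat \<Rightarrow> nat" and lam :: "nat \<Rightarrow> nat \<Rightarrow> real"
    and M :: "real mat" and ws :: "(nat \<times> 'b) list"
  assumes "0 \<le> \<alpha>" and "\<alpha> \<le> 1"
    and "pair_graph G" and "vertex_enum G vs" and "length vs = n" and "3 \<le> n"
    and "card (edges G) = m"
    and "\<forall>i<n. regular_graph (r i) (Gs i)"
    and "\<forall>i<n. card (pverts (Gs i)) = ord i \<and> 1 \<le> ord i"
    and "\<forall>i<n. vertex_enum (Gs i) (us i)"
    and "\<forall>i<n. eigvals_mset (adjacency_mat (Gs i) (us i)) =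
                 {# complex_of_real (lam i k). k \<in># mset_set {..<ord i} #}"
    and "\<forall>i<n. lam i 0 = real (r i) \<and> (\<forall>k l. k \<le> l \<and> l < ord i \<longrightarrow> lam i l \<le> lam i k)"
    and "\<forall>i<n. s i = (\<Sum>j | j < n \<and> vs ! j \<in> neighbours G (vs ! i). ord j)"
    and "M = mat n n (\<lambda>(i, j). if i = j then \<alpha> * real (s i) + real (r i)
                               else if (vs ! i, vs ! j) \<in> parcs G then (1 - \<alpha>) * real (ord j)
                               else 0)"
    and "vertex_enum (joined_union G vs Gs) ws"
  shows "card (pverts (joined_union G vs Gs)) = (\<Sum>i<n. ord i) \<and>
         eigvals_mset (A_alpha_mat \<alpha> (joined_union G vs Gs) ws) =
           (\<Sum>i<n. {# complex_of_real (\<alpha> * real (r i + s i) + (1 - \<alpha>) * lam i k).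
                       k \<in># mset_set {1..<ord i} #})
           + eigvals_mset M"
proof -
  note G = assms(3) and vs = assms(4) and n = assms(5) and reg = assms(8)
    and ord = assms(9) and us = assms(10) and lam = assms(11) and lam0 = assms(12)
    and s = assms(13) and M = assms(14) and ws = assms(15)
  let ?H = "joined_union G vs Gs"
  let ?N = "length ws"

  \<comment> \<open>Vertices and degrees of the joined union\<close>
  have fin: "finite (pverts (Gs i))" and card_Gs: "card (pverts (Gs i)) = ord i" if "i < n" for i
  proof -
    show "card (pverts (Gs i)) = ord i" using ord that by blast
    \<comment> \<open>An infinite set has \<open>card\<close> 0, so \<open>1 \<le> ord i\<close>
      forces finiteness.\<close>
    then show "finite (pverts (Gs i))" using ord that by (intro card_ge_0_finite) auto
  qed
  have set_ws: "set ws = (SIGMA i:{..<n}. pverts (Gs i))" and dist_ws: "distinct ws"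
    using ws n by (auto simp: vertex_enum_def joined_union_def)
  have set_us: "set (us i) = pverts (Gs i)" and dist_us: "distinct (us i)" if "i < n" for i
    using us that by (auto simp: vertex_enum_def)
  interpret G: pair_graph G by (rule G)
  have no_loop: "(v, v) \<notin> parcs G" for v using G.pair_no_loops by fastforce
  have ws_nth: "fst (ws ! a) < n \<and> snd (ws ! a) \<in> pverts (Gs (fst (ws ! a)))" if "a < ?N" for a
    using nth_mem[OF that] unfolding set_ws by auto
  have card_nb: "card (neighbours (Gs i) x) = r i" if "i < n" "x \<in> pverts (Gs i)" for i x
    using reg that by (auto simp: regular_graph_def)
  have deg: "card (neighbours ?H (i, x)) = r i + s i" if "i < n" "x \<in> pverts (Gs i)" for i x
  proof -
    have "card (neighbours ?H (i, x)) = card (neighbours (Gs i) x) +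
        (\<Sum>j | j < n \<and> vs ! j \<in> neighbours G (vs ! i). card (pverts (Gs j)))"
      using card_neighbours_joined_union[OF G, of vs Gs i x] fin vs n that
      by (auto simp: vertex_enum_def)
    also have "\<dots> = r i + s i"
      using card_nb[OF that] s that by (auto simp: card_Gs intro: sum.cong)
    finally show ?thesis .
  qed

  \<comment> \<open>The decomposition into a block diagonal matrix and a low rank term\<close>
  define c :: "nat \<Rightarrow> complex" where "c i = of_real (\<alpha> * real (r i + s i))" for i
  define d :: complex where "d = of_real (1 - \<alpha>)"
  \<comment> \<open>This is the eigenvalue of the i-th block of \<open>?B\<close> that comes from
    the adjacency eigenvalue \<open>r i\<close>, and also the constant row sum of that
    block.\<close>
  define \<mu> :: "nat \<Rightarrow> complex" where "\<mu> i = of_real (\<alpha> * real (s i) + real (r i))" for i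
  have \<mu>_eq: "\<mu> i = c i + d * of_nat (r i)" for i
    by (simp add: \<mu>_def c_def d_def algebra_simps)
  define b :: "nat \<times> 'b \<Rightarrow> nat \<times> 'b \<Rightarrow> complex" where
    "b = (\<lambda>(i, x) (j, y). if i = j
      then (if x = y then c i else 0) + (if (x, y) \<in> parcs (Gs i) then d else 0) else 0)"
  let ?B = "list_mat b ws"
  define U :: "complex mat" where "U = mat ?N n (\<lambda>(a, j). if fst (ws ! a) = j then 1 else 0)"
  define W :: "complex mat" where
    "W = mat n ?N (\<lambda>(i, b). if (vs ! i, vs ! fst (ws ! b)) \<in> parcs G then d else 0)"
  define L :: "complex mat" where "L = mat n n (\<lambda>(i, j). if i = j then \<mu> i else 0)"
  have carrier: "?B \<in> carrier_mat ?N ?N" "U \<in> carrier_mat ?N n" "W \<in> carrier_mat n ?N"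
    "L \<in> carrier_mat n n"
    by (auto simp: U_def W_def L_def)
  \<comment> \<open>Weighting with column \<open>j\<close> of \<open>U\<close> restricts a sum over
    all vertices to those tagged \<open>j\<close>; both \<open>?B * U\<close> and
    \<open>W * U\<close> are evaluated this way.\<close>
  have sum_part: "(\<Sum>a = 0..<?N. f (ws ! a) * (if fst (ws ! a) = j then 1 else 0)) =
      (\<Sum>y\<in>pverts (Gs j). f (j, y))" if "j < n" for j and f :: "nat \<times> 'b \<Rightarrow> complex"
  proof -
    have "(\<Sum>a = 0..<?N. f (ws ! a) * (if fst (ws ! a) = j then 1 else 0)) =
        (\<Sum>v\<in>set ws. f v * (if fst v = j then 1 else 0))"
      by (rule sum_nth_conv_sum_set[OF dist_ws])
    also have "\<dots> = (\<Sum>v\<in>Pair j ` pverts (Gs j). f v)"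
      using that by (intro sum.mono_neutral_cong_right) (auto simp: set_ws fin)
    also have "\<dots> = (\<Sum>y\<in>pverts (Gs j). f (j, y))"
      by (simp add: sum.reindex inj_on_def)
    finally show ?thesis .
  qed

  \<comment> \<open>Row \<open>a\<close> of \<open>U\<close> has a single 1, at the tag of
    \<open>ws ! a\<close>, so it selects one row of \<open>W\<close>.\<close>
  have UW: "(U * W) $$ (a, e) = (if (vs ! fst (ws ! a), vs ! fst (ws ! e)) \<in> parcs G then d else 0)"
    if "a < ?N" "e < ?N" for a e
  proof -
    have "(U * W) $$ (a, e) = (\<Sum>j = 0..<n. U $$ (a, j) * W $$ (j, e))"
      using that by (simp add: scalar_prod_def U_def W_def)
    also have "\<dots> = (\<Sum>j = 0..<n. if fst (ws ! a) = j then W $$ (j, e) else 0)"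
      using that by (intro sum.cong) (simp_all add: U_def)
    also have "\<dots> = W $$ (fst (ws ! a), e)" using ws_nth[OF that(1)] by simp
    also have "\<dots> = (if (vs ! fst (ws ! a), vs ! fst (ws ! e)) \<in> parcs G then d else 0)"
      using ws_nth[OF that(1)] that by (simp add: W_def)
    finally show ?thesis .
  qed
  have A: "map_mat complex_of_real (A_alpha_mat \<alpha> ?H ws) = ?B + U * W"
  proof (rule eq_matI)
    fix a e assume "a < dim_row (?B + U * W)" "e < dim_col (?B + U * W)"
    then have ae: "a < ?N" "e < ?N" by (simp_all add: U_def W_def)
    obtain i x where ix: "ws ! a = (i, x)" by force
    obtain j y where jy: "ws ! e = (j, y)" by force
    have ij: "i < n" "x \<in> pverts (Gs i)" "j < n" "y \<in> pverts (Gs j)"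
      using ws_nth[OF ae(1)] ws_nth[OF ae(2)] ix jy by auto
    have eq: "a = e \<longleftrightarrow> i = j \<and> x = y"
      using nth_eq_iff_index_eq[OF dist_ws ae] ix jy by auto
    have "map_mat complex_of_real (A_alpha_mat \<alpha> ?H ws) $$ (a, e) =
        (if i = j \<and> x = y then c i else 0) + (if ((i, x), (j, y)) \<in> parcs ?H then d else 0)"
      using ae ij deg by (simp add: A_alpha_mat_def degree_mat_def adjacency_mat_def ix jy eq c_def d_def)
    \<comment> \<open>The two kinds of arcs exclude each other: an arc of \<open>G\<close> from
      \<open>vs ! i\<close> to \<open>vs ! j\<close> forces i and j to differ. Hence the indicator
      of the disjunction is a sum of two indicators.\<close>
    also have "\<dots> = b (i, x) (j, y) + (if (vs ! i, vs ! j) \<in> parcs G then d else 0)"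
      using ij n no_loop by (auto simp: b_def parcs_joined_union)
    also have "\<dots> = (?B + U * W) $$ (a, e)"
      using ae carrier UW[OF ae] by (simp add: list_mat_def ix jy)
    finally show "map_mat complex_of_real (A_alpha_mat \<alpha> ?H ws) $$ (a, e) = (?B + U * W) $$ (a, e)" .
  qed (auto simp: A_alpha_mat_def degree_mat_def adjacency_mat_def U_def W_def)

  \<comment> \<open>Row sums of the blocks and the quotient matrix\<close>
  have row_sum: "(\<Sum>y\<in>pverts (Gs j). b (i, x) (j, y)) = (if i = j then \<mu> i else 0)"
    if "i < n" "j < n" "x \<in> pverts (Gs i)" for i j x
  proof (cases "i = j")
    case True
    have "(\<Sum>y\<in>pverts (Gs i). b (i, x) (i, y)) =
        (\<Sum>y\<in>pverts (Gs i). if x = y then c i else 0) +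
        (\<Sum>y\<in>pverts (Gs i). if (x, y) \<in> parcs (Gs i) then d else 0)"
      by (simp add: b_def sum.distrib)
    also have "(\<Sum>y\<in>pverts (Gs i). if x = y then c i else 0) = c i"
      using that fin by simp
    also have "(\<Sum>y\<in>pverts (Gs i). if (x, y) \<in> parcs (Gs i) then d else 0) =
        (\<Sum>y\<in>neighbours (Gs i) x. d)"
      using that fin by (intro sum.mono_neutral_cong_right) (auto simp: neighbours_def)
    \<comment> \<open>Regularity enters here: the number of neighbours does not depend on
      \<open>x\<close>, so the row sum is constant on the block.\<close>
    also have "\<dots> = d * of_nat (r i)" using card_nb that by simp
    finally show ?thesis using True by (simp add: \<mu>_eq)
  qed (simp add: b_def)
  have BU: "?B * U = U * L"
  proof (rule eq_matI)
    fix a j assume "a < dim_row (U * L)" "j < dim_col (U * L)"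
    then have aj: "a < ?N" "j < n" by (simp_all add: U_def L_def)
    obtain i x where ix: "ws ! a = (i, x)" by force
    have i: "i < n" "x \<in> pverts (Gs i)" using ws_nth[OF aj(1)] ix by auto
    have "(?B * U) $$ (a, j) = (\<Sum>e = 0..<?N. b (i, x) (ws ! e) * (if fst (ws ! e) = j then 1 else 0))"
      using aj by (auto simp: scalar_prod_def U_def list_mat_def ix intro!: sum.cong)
    also have "\<dots> = (if i = j then \<mu> i else 0)"
      using sum_part[OF aj(2)] row_sum[OF i(1) aj(2) i(2)] by simp
    also have "\<dots> = (\<Sum>k = 0..<n. if i = k then L $$ (k, j) else 0)"
      using i aj by (simp add: L_def)
    also have "\<dots> = (\<Sum>k = 0..<n. U $$ (a, k) * L $$ (k, j))"
      using aj by (intro sum.cong) (simp_all add: U_def ix)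
    also have "\<dots> = (U * L) $$ (a, j)"
      using aj by (simp add: scalar_prod_def U_def L_def)
    finally show "(?B * U) $$ (a, j) = (U * L) $$ (a, j)" .
  qed (auto simp: U_def L_def list_mat_def)

  have LWU: "L + W * U = map_mat complex_of_real M"
  proof (rule eq_matI)
    fix i j assume "i < dim_row (map_mat complex_of_real M)" "j < dim_col (map_mat complex_of_real M)"
    then have ij: "i < n" "j < n" by (simp_all add: M)
    have "(W * U) $$ (i, j) = (\<Sum>e = 0..<?N. (\<lambda>v. if (vs ! i, vs ! fst v) \<in> parcs G then d else 0) (ws ! e)
        * (if fst (ws ! e) = j then 1 else 0))"
      using ij by (auto simp: scalar_prod_def U_def W_def intro!: sum.cong)
    also have "\<dots> = (if (vs ! i, vs ! j) \<in> parcs G then d * of_nat (ord j) else 0)"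
      by (subst sum_part[OF ij(2)]) (simp add: card_Gs ij)
    \<comment> \<open>On the diagonal \<open>W * U\<close> vanishes because \<open>G\<close> is
      loop-free, leaving the entry of \<open>L\<close>; off the diagonal \<open>L\<close> vanishes,
      leaving that of \<open>W * U\<close>.\<close>
    finally show "(L + W * U) $$ (i, j) = map_mat complex_of_real M $$ (i, j)"
      using ij no_loop carrier by (auto simp: M L_def \<mu>_def d_def)
  qed (auto simp: M U_def W_def)

  \<comment> \<open>The spectrum of the block diagonal matrix\<close>
  let ?xss = "map (\<lambda>i. map (Pair i) (us i)) [0..<n]"
  have "distinct (concat ?xss)"
    using dist_us by (intro distinct_concat_tagged) auto
  moreover have "set (concat ?xss) = set ws"
    using set_us by (auto simp: set_ws)
  \<comment> \<open>The order of \<open>ws\<close> is arbitrary; grouping the vertices by tag makes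
    the matrix of \<open>b\<close> visibly block diagonal without changing its spectrum.\<close>
  ultimately have "mset ws = mset (concat ?xss)"
    using set_eq_iff_mset_eq_distinct[OF dist_ws] by metis
  then have "spectrum_mset ?B = spectrum_mset (list_mat b (concat ?xss))"
    by (rule arg_cong[OF char_poly_list_mat_permute])
  also have "\<dots> = (\<Sum>xs\<leftarrow>?xss. spectrum_mset (list_mat b xs))"
  proof (rule spectrum_mset_list_mat_concat)
    show "sorted_wrt (\<lambda>xs ys. \<forall>x\<in>set xs. \<forall>y\<in>set ys. b x y = 0) ?xss"
      unfolding sorted_wrt_map
      by (rule sorted_wrt_mono_rel[OF _ sorted_wrt_upt]) (auto simp: b_def)
  qed
  also have "\<dots> = (\<Sum>i<n. spectrum_mset (list_mat b (map (Pair i) (us i))))"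
    by (simp add: o_def interv_sum_list_conv_sum_set_nat lessThan_atLeast0)
  also have "\<dots> = (\<Sum>i<n. {#\<mu> i#} + {#c i + d * of_real (lam i k). k \<in># mset_set {1..<ord i}#})"
  proof (rule sum.cong)
    fix i assume "i \<in> {..<n}"
    then have i: "i < n" by simp
    let ?A = "map_mat complex_of_real (adjacency_mat (Gs i) (us i))"
    have "list_mat b (map (Pair i) (us i)) = c i \<cdot>\<^sub>m 1\<^sub>m (length (us i)) + d \<cdot>\<^sub>m ?A"
      using dist_us[OF i]
      by (intro eq_matI) (auto simp: list_mat_def b_def adjacency_mat_def nth_eq_iff_index_eq)
    then have "spectrum_mset (list_mat b (map (Pair i) (us i))) =
        image_mset (\<lambda>a. c i + d * a) (spectrum_mset ?A)"
      by (simp add: spectrum_mset_affine adjacency_mat_def)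
    also have "spectrum_mset ?A = {#complex_of_real (lam i k). k \<in># mset_set {..<ord i}#}"
      using lam i by (simp add: eigvals_mset_def)
    \<comment> \<open>Index 0 exists since \<open>ord i\<close> is positive. It carries
      \<open>lam i 0 = r i\<close>, which the affine map sends to \<open>\<mu> i\<close>.\<close>
    also have "{..<ord i} = insert 0 {1..<ord i}" using ord i by auto
    finally show "spectrum_mset (list_mat b (map (Pair i) (us i))) =
        {#\<mu> i#} + {#c i + d * of_real (lam i k). k \<in># mset_set {1..<ord i}#}"
      using lam0 i by (simp add: \<mu>_eq image_mset.compositionality o_def)
  qed simp
  also have "\<dots> = (\<Sum>i<n. {#\<mu> i#}) +
      (\<Sum>i<n. {#c i + d * of_real (lam i k). k \<in># mset_set {1..<ord i}#})"
    by (rule sum.distrib)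
  also have "(\<Sum>i<n. {#\<mu> i#}) = spectrum_mset L"
  proof -
    have "diag_mat L = map \<mu> [0..<n]" by (simp add: diag_mat_def L_def)
    moreover have "(\<Sum>i<k. {#\<mu> i#}) = mset (map \<mu> [0..<k])" for k by (induction k) auto
    ultimately show ?thesis
      using spectrum_mset_upper_triangular[OF carrier(4)]
      by (simp add: upper_triangular_def L_def)
  qed
  \<comment> \<open>The spectrum of \<open>L\<close> occurs on both sides of the identity from
    \<open>spectrum_mset_equitable\<close>, and multiset addition is cancellative.\<close>
  finally have "spectrum_mset (?B + U * W) =
      (\<Sum>i<n. {#c i + d * of_real (lam i k). k \<in># mset_set {1..<ord i}#}) + spectrum_mset (L + W * U)"
    using spectrum_mset_equitable[OF carrier BU] by (simp add: ac_simps)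
  then have "eigvals_mset (A_alpha_mat \<alpha> ?H ws) =
      (\<Sum>i<n. {# complex_of_real (\<alpha> * real (r i + s i) + (1 - \<alpha>) * lam i k).
         k \<in># mset_set {1..<ord i} #}) + eigvals_mset M"
    unfolding eigvals_mset_def A LWU by (simp add: c_def d_def)
  moreover have "card (pverts ?H) = (\<Sum>i<n. ord i)"
    using fin card_Gs n by (simp add: joined_union_def card_SigmaI)
  ultimately show ?thesis by blast
qed

end
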